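(* Let $\mathcal{A}$ be a unital associative algebra over $\mathbb{Q}$, $\mathcal{C}\subseteq\mathcal{A}$ a commutative subalgebra, $\mathcal{I}$ the Lie idealiser of $\mathcal{C}$ in $\mathcal{A}$, and $d\in\mathcal{I}\setminus\mathcal{C}$. The free Lie algebra generated by $\mathcal{C}$ and $\mathcal{P}(d)$ (the ring of polynomials in $d$ with constant coefficients) is contained in $\mathfrak{F}$: $$\mathfrak{g}:=\mathrm{FLA}(\mathcal{C}\cup\mathcal{P}(d))\subseteq\mathfrak{F}.$$ The two are identical, $\mathfrak{g}=\mathfrak{F}$, if an inverse of the mapping $D=\mathrm{ad}_d:\mathcal{C}\to\mathcal{C}$ exists.
   Context: The commutator is $[a,b]=a\cdot b-b\cdot a$ and $\mathrm{ad}_d(a)=[d,a]$. The Lie idealiser of $\mathcal{C}$ in $\mathcal{A}$ is $\mathcal{I}=\{d\in\mathcal{A}: [d,\mathcal{C}]\subseteq\mathcal{C}\}$, so $\mathrm{ad}_d$ maps $\mathcal{C}$ to $\mathcal{C}$ for $d\in\mathcal{I}$. For $x\in\mathcal{C}$ and an integer $k\ge 0$, $\langle x\rangle_k=\tfrac12(x\cdot d^k+d^k\cdot x)$, with $d^0=1_{\mathcal{A}}$; $\mathfrak{F}_k$ is the linear space $\{\langle x\rangle_k: x\in\mathcal{C}\}$; and $\mathfrak{F}=\bigoplus_{k\ge 0}\mathfrak{F}_k$ denotes the direct sum of these linear spaces, which is a Lie algebra under the commutator. The free Lie algebra $\mathrm{FLA}(X)$ generated by a set $X$ means here the intersection of all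 Lie algebras (under the commutator) containing $X$. *)

theory Defs
  imports Complex_Main "HOL-Computational_Algebra.Polynomial"
begin

(* The class ring_1 imposes 0 \<noteq> 1. Only the zero algebra is excluded, and it has no element
   outside a subalgebra. *)
locale rational_algebra = vector_space scale
  for scale :: "rat \<Rightarrow> 'a::ring_1 \<Rightarrow> 'a" +
  assumes scale_mult_left: "scale q a * b = scale q (a * b)"
    and scale_mult_right: "a * scale q b = scale q (a * b)"

definition commutator :: "'a::ring_1 \<Rightarrow> 'a \<Rightarrow> 'a" where
  "commutator a b = a * b - b * a"

definition ad :: "'a::ring_1 \<Rightarrow> 'a \<Rightarrow> 'a" where
  "ad d a = commutator d a"

definition lie_idealiser :: "'a::ring_1 set \<Rightarrow> 'a set" where
  "lie_idealiser C = {d. \<forall>c\<in>C. commutator d c \<in> C}"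

context rational_algebra
begin

(* A subalgebra of a unital algebra is understood to contain the unit. Without this, d itself
   need not lie in sym_space C d (take C = {0} and d \<noteq> 0). *)
definition commutative_subalgebra :: "'a set \<Rightarrow> bool" where
  "commutative_subalgebra C \<longleftrightarrow>
     subspace C \<and> 1 \<in> C \<and> (\<forall>x\<in>C. \<forall>y\<in>C. x * y \<in> C) \<and> (\<forall>x\<in>C. \<forall>y\<in>C. x * y = y * x)"

definition lie_subalgebra :: "'a set \<Rightarrow> bool" where
  "lie_subalgebra L \<longleftrightarrow> subspace L \<and> (\<forall>x\<in>L. \<forall>y\<in>L. commutator x y \<in> L)"

(* "Free" Lie algebra in the sense of the smallest Lie algebra inside the ambient algebra;
   no universal property is meant. *)
definition FLA :: "'a set \<Rightarrow> 'a set" where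
  "FLA X = \<Inter>{L. lie_subalgebra L \<and> X \<subseteq> L}"

(* The library's poly requires a commutative coefficient ring, so evaluation of a rational
   polynomial at an element of the algebra is spelled out. *)
definition poly_at :: "'a \<Rightarrow> rat poly \<Rightarrow> 'a" where
  "poly_at d p = (\<Sum>i\<le>degree p. scale (coeff p i) (d ^ i))"

definition polys_in :: "'a \<Rightarrow> 'a set" where
  "polys_in d = range (poly_at d)"

definition symmetrised :: "'a \<Rightarrow> nat \<Rightarrow> 'a \<Rightarrow> 'a" where
  "symmetrised d k x = scale (1 / 2) (x * d ^ k + d ^ k * x)"

definition sym_component :: "'a set \<Rightarrow> 'a \<Rightarrow> nat \<Rightarrow> 'a set" where
  "sym_component C d k = {symmetrised d k x | x. x \<in> C}"

(* The sum of the components over all k, as a subspace of the algebra: all finite sums with one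
   term from each component. When the components are independent this is their (internal) direct
   sum; independence is not imposed, as it can fail (C the rational scalars, d ^ 2 = 1). *)
definition sym_space :: "'a set \<Rightarrow> 'a \<Rightarrow> 'a set" where
  "sym_space C d = {\<Sum>k<n. f k | n f. \<forall>k<n. f k \<in> sym_component C d k}"

end

(* Since ad d 1 = 0 and 1 \<in> C, the map ad d is never injective on C, so an "inverse" can only be
   a right inverse (an antiderivative, when ad d is differentiation). A two-sided inverse is in
   particular a right inverse; E is not required to be linear. *)
definition right_inverse_on :: "'a set \<Rightarrow> ('a \<Rightarrow> 'a) \<Rightarrow> ('a \<Rightarrow> 'a) \<Rightarrow> bool" where
  "right_inverse_on C D E \<longleftrightarrow> (\<forall>x\<in>C. E x \<in> C \<and> D (E x) = x)"

end

(* With M n the span of all x d^k, x in C, k < n, the commutation rule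
   d^(k+1) y = y d^(k+1) + (k+1) [d, y] d^k  modulo  M k  makes the union of the M n an associative
   subalgebra containing C and d, and shows, by descending on the degree, that it coincides with
   the symmetrised space; this gives the inclusion. If every x in C is [d, y] for some y in C,
   the same rule expresses x d^k through [d^(k+1), y] and terms of M k, so that by induction on k
   every M k lies in each Lie algebra containing C and the powers of d. *)
theory Submission
  imports Defs
begin

text \<open>Places the powers of \<open>d\<close> in \<open>polys_in d\<close>, which the reverse
  inclusion relies on.\<close>

lemma (in rational_algebra) poly_at_monom: "poly_at a (monom 1 k) = a ^ k"
proof -
  have "poly_at a (monom 1 k) = (\<Sum>i\<le>k. scale (if k = i then 1 else 0) (a ^ i))"
    by (simp add: poly_at_def degree_monom_eq)
  also have "\<dots> = (\<Sum>i\<le>k. if k = i then a ^ i else 0)"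
    by (intro sum.cong) auto
  finally show ?thesis by simp
qed

section \<open>The filtration by degree in \<open>d\<close>\<close>

locale commutative_subalgebra_idealised = rational_algebra scale
  for scale :: "rat \<Rightarrow> 'a::ring_1 \<Rightarrow> 'a" +
  fixes C :: "'a set" and d :: 'a
  assumes C: "commutative_subalgebra C"
    and d_idealises: "d \<in> lie_idealiser C"
begin

lemma subspace_C: "subspace C"
  and one_in_C: "1 \<in> C"
  and mult_in_C: "x \<in> C \<Longrightarrow> y \<in> C \<Longrightarrow> x * y \<in> C"
  using C by (auto simp: commutative_subalgebra_def)

lemma ad_in_C: "x \<in> C \<Longrightarrow> ad d x \<in> C"
  using d_idealises by (auto simp: lie_idealiser_def ad_def)

lemma d_mult: "d * x = x * d + ad d x"
  by (simp add: ad_def commutator_def)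

text \<open>A span replaces a degree function because the powers of \<open>d\<close> may be
  dependent over \<open>C\<close>. The strict bound makes \<open>filtration 0\<close> the zero
  space, where the inductions on the index start.\<close>

definition filtration :: "nat \<Rightarrow> 'a set" where
  "filtration n = span {x * d ^ k | x k. x \<in> C \<and> k < n}"

lemma subspace_filtration: "subspace (filtration n)"
  by (simp add: filtration_def)

lemmas filtration_add = subspace_add[OF subspace_filtration]
  and filtration_diff = subspace_diff[OF subspace_filtration]
  and filtration_scale = subspace_scale[OF subspace_filtration]
  and filtration_zero = subspace_0[OF subspace_filtration]

lemma filtration_gen: "x \<in> C \<Longrightarrow> k < n \<Longrightarrow> x * d ^ k \<in> filtration n"
  unfolding filtration_def by (rule span_base) auto

lemma filtration_mono: "m \<le> n \<Longrightarrow> filtration m \<subseteq> filtration n"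
  unfolding filtration_def by (rule span_mono) force

text \<open>The elements satisfying \<open>P\<close> form a subspace that contains the generators,
  hence their span. Later claims thus reduce to monomials \<open>x * d ^ k\<close>.\<close>

lemma filtration_induct [consumes 1, case_names zero add scale gen]:
  assumes "a \<in> filtration n"
    and "P 0" and "\<And>a b. P a \<Longrightarrow> P b \<Longrightarrow> P (a + b)" and "\<And>q a. P a \<Longrightarrow> P (scale q a)"
    and "\<And>x k. x \<in> C \<Longrightarrow> k < n \<Longrightarrow> P (x * d ^ k)"
  shows "P a"
proof -
  have "subspace {a. P a}"
    using assms(2-4) by (auto intro: subspaceI)
  then have "filtration n \<subseteq> {a. P a}"
    unfolding filtration_def using assms(5) by (intro span_minimal) auto
  then show ?thesis using assms(1) by auto
qed

lemma C_mult_filtration: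
  assumes "a \<in> filtration n" "c \<in> C"
  shows "c * a \<in> filtration n"
  using assms(1)
proof (induction rule: filtration_induct)
  case (gen x k)
  then show ?case
    using filtration_gen[of "c * x" k n] assms(2) by (simp add: mult_in_C mult.assoc)
qed (simp_all add: filtration_zero filtration_add filtration_scale distrib_left scale_mult_right)

lemma filtration_mult_d:
  assumes "a \<in> filtration n"
  shows "a * d \<in> filtration (Suc n)"
  using assms
proof (induction rule: filtration_induct)
  case (gen x k)
  then show ?case
    using filtration_gen[of x "Suc k" "Suc n"] by (simp add: mult.assoc power_commutes)
qed (simp_all add: filtration_zero filtration_add filtration_scale distrib_right scale_mult_left)

text \<open>Moving \<open>d\<close> to the right past a coefficient \<open>x\<close> costs only the
  term with coefficient \<open>ad d x\<close>. It stays in \<open>C\<close> because \<open>d\<close>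
  idealises \<open>C\<close>, and its degree does not grow.\<close>

lemma d_mult_filtration:
  assumes "a \<in> filtration n"
  shows "d * a \<in> filtration (Suc n)"
  using assms
proof (induction rule: filtration_induct)
  case (gen x k)
  have "d * (x * d ^ k) = x * d ^ Suc k + ad d x * d ^ k"
    using d_mult[of x] by (metis distrib_right mult.assoc power_Suc)
  then show ?case
    using gen by (simp add: filtration_add filtration_gen ad_in_C del: power_Suc)
qed (simp_all add: filtration_zero filtration_add filtration_scale distrib_left scale_mult_right)

lemma power_mult_filtration: "a \<in> filtration n \<Longrightarrow> d ^ k * a \<in> filtration (k + n)"
  by (induction k) (simp_all add: d_mult_filtration mult.assoc)

lemma filtration_mult:
  assumes "a \<in> filtration m" "b \<in> filtration n"
  shows "a * b \<in> filtration (m + n)"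
  using assms(1)
proof (induction rule: filtration_induct)
  case (gen x k)
  then have "x * d ^ k * b \<in> filtration (k + n)"
    using assms(2) by (simp add: mult.assoc C_mult_filtration power_mult_filtration)
  with gen show ?case using filtration_mono[of "k + n" "m + n"] by auto
qed (simp_all add: filtration_zero filtration_add filtration_scale distrib_right scale_mult_left)

section \<open>Leading terms of commutators and symmetrised products\<close>

text \<open>These are the first two terms of the Leibniz expansion of \<open>d ^ Suc k * y\<close>
  with coefficients on the left. Every further term differentiates \<open>y\<close> at least twice,
  so its degree is below \<open>k\<close>.\<close>

lemma power_commutation:
  assumes "y \<in> C"
  shows "d ^ Suc k * y - y * d ^ Suc k - scale (of_nat (Suc k)) (ad d y * d ^ k) \<in> filtration k"
  using assms
\<comment> \<open>The step applies the hypothesis to \<open>ad d y\<close> as well as to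
  \<open>y\<close>.\<close>
proof (induction k arbitrary: y)
  case 0
  then show ?case by (simp add: d_mult[of y] filtration_zero)
next
  case (Suc k)
  \<comment> \<open>Naming the remainder turns the hypothesis into the rewrite rule
    \<open>eq\<close>.\<close>
  define r where "r z = d ^ Suc k * z - z * d ^ Suc k - scale (of_nat (Suc k)) (ad d z * d ^ k)" for z
  have r: "r z \<in> filtration k" if "z \<in> C" for z
    using Suc.IH[OF that] by (simp add: r_def)
  have eq: "d ^ Suc k * z = z * d ^ Suc k + scale (of_nat (Suc k)) (ad d z * d ^ k) + r z" for z
    by (simp add: r_def)
  have pow: "d ^ j * d = d ^ Suc j" for j by (simp add: power_commutes)
  have "d ^ Suc (Suc k) * y = d ^ Suc k * y * d + d ^ Suc k * ad d y"
    by (simp only: power_Suc2[of _ "Suc k"] mult.assoc d_mult[of y] distrib_left)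
  also have "\<dots> = y * d ^ Suc (Suc k) + scale (of_nat (Suc k)) (ad d y * d ^ Suc k) + r y * d
      + (ad d y * d ^ Suc k + scale (of_nat (Suc k)) (ad d (ad d y) * d ^ k) + r (ad d y))"
    unfolding eq distrib_right scale_mult_left mult.assoc pow by simp
  finally have "d ^ Suc (Suc k) * y - y * d ^ Suc (Suc k)
      - scale (of_nat (Suc (Suc k))) (ad d y * d ^ Suc k)
      = r y * d + (scale (of_nat (Suc k)) (ad d (ad d y) * d ^ k) + r (ad d y))"
    \<comment> \<open>The coefficient \<open>Suc (Suc k)\<close> arises as \<open>Suc k\<close> from
      expanding at \<open>y\<close> plus 1 from expanding at \<open>ad d y\<close>.\<close>
    unfolding of_nat_Suc[of "Suc k"] scale_left_distrib
    by (simp add: algebra_simps del: power_Suc of_nat_Suc)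
  moreover have "r y * d \<in> filtration (Suc k)"
    using r Suc.prems by (simp add: filtration_mult_d)
  moreover have "r (ad d y) \<in> filtration (Suc k)"
    using r[of "ad d y"] Suc.prems filtration_mono[of k "Suc k"] by (auto simp: ad_in_C)
  ultimately show ?case
    using Suc.prems by (simp only: filtration_add filtration_scale filtration_gen ad_in_C lessI)
qed

text \<open>Modulo lower degree, \<open>d ^ k * x\<close> equals \<open>x * d ^ k\<close>, so the
  two halves of the symmetrised product add up to one copy of that monomial.\<close>

lemma symmetrised_leading_term:
  assumes "x \<in> C"
  shows "symmetrised d k x - x * d ^ k \<in> filtration k"
proof -
  have "d ^ k * x - x * d ^ k \<in> filtration k"
  proof (cases k)
    case (Suc j)
    have "scale (of_nat (Suc j)) (ad d x * d ^ j) \<in> filtration k"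
      using assms Suc by (intro filtration_scale filtration_gen ad_in_C) auto
    moreover have "d ^ k * x - x * d ^ k - scale (of_nat (Suc j)) (ad d x * d ^ j) \<in> filtration k"
      using power_commutation[OF assms, of j] filtration_mono[of j k] Suc by auto
    ultimately show ?thesis
      using filtration_add by fastforce
  qed (simp add: filtration_zero)
  moreover have "symmetrised d k x - x * d ^ k = scale (1 / 2) (d ^ k * x - x * d ^ k)"
  proof -
    have "x * d ^ k = scale (1 / 2 + 1 / 2) (x * d ^ k)" by simp
    then have "x * d ^ k = scale (1 / 2) (x * d ^ k) + scale (1 / 2) (x * d ^ k)"
      by (simp only: scale_left_distrib)
    then show ?thesis
      by (simp add: symmetrised_def scale_right_distrib scale_right_diff_distrib algebra_simps)
  qed
  ultimately show ?thesis by (simp add: filtration_scale)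
qed

section \<open>Expansion in symmetrised elements\<close>

text \<open>Provides a leading coefficient \<open>x\<close> for descent on the degree. Only
  existence is claimed, since dependence among the powers of \<open>d\<close> can make
  \<open>x\<close> ambiguous.\<close>

lemma filtration_Suc_split:
  assumes "a \<in> filtration (Suc n)"
  shows "\<exists>x\<in>C. a - x * d ^ n \<in> filtration n"
  using assms
proof (induction rule: filtration_induct)
  case zero
  show ?case using subspace_0[OF subspace_C] by (force simp: filtration_zero)
next
  case (add a b)
  then obtain x y where "x \<in> C" "y \<in> C"
    and "a - x * d ^ n \<in> filtration n" "b - y * d ^ n \<in> filtration n" by blast
  then show ?case
    using filtration_add[of "a - x * d ^ n" n "b - y * d ^ n"]
    by (intro bexI[of _ "x + y"]) (auto simp: algebra_simps subspace_add[OF subspace_C])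
next
  case (scale q a)
  then obtain x where "x \<in> C" and "a - x * d ^ n \<in> filtration n" by blast
  then show ?case
    using filtration_scale[of "a - x * d ^ n" n q]
    by (intro bexI[of _ "scale q x"])
      (auto simp: scale_right_diff_distrib scale_mult_left subspace_scale[OF subspace_C])
next
  case (gen x k)
  show ?case
  proof (cases "k = n")
    case True
    with gen show ?thesis by (intro bexI[of _ x]) (auto simp: filtration_zero)
  next
    case False
    with gen subspace_0[OF subspace_C] show ?thesis
      by (intro bexI[of _ 0]) (auto intro: filtration_gen)
  qed
qed

text \<open>Subtracting \<open>symmetrised d n x\<close>, with \<open>x\<close> a leading
  coefficient of \<open>a\<close>, cancels the top term and leaves an element of lower
  degree.\<close>

lemma filtration_sym_sum:
  assumes "a \<in> filtration n"
  shows "\<exists>f. (\<forall>k<n. f k \<in> sym_component C d k) \<and> a = (\<Sum>k<n. f k)"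
  using assms
proof (induction n arbitrary: a)
  case 0
  then show ?case by (simp add: filtration_def)
next
  case (Suc n)
  obtain x where x: "x \<in> C" "a - x * d ^ n \<in> filtration n"
    using filtration_Suc_split[OF Suc.prems] by blast
  have "a - symmetrised d n x \<in> filtration n"
    using filtration_diff[OF x(2) symmetrised_leading_term[OF x(1)]] by simp
  then obtain f where f: "\<forall>k<n. f k \<in> sym_component C d k" "a - symmetrised d n x = (\<Sum>k<n. f k)"
    using Suc.IH by blast
  let ?g = "f(n := symmetrised d n x)"
  have "(\<Sum>k<n. ?g k) = (\<Sum>k<n. f k)" by (intro sum.cong) auto
  then have "a = (\<Sum>k<Suc n. ?g k)" using f(2) by (simp add: algebra_simps)
  moreover have "\<forall>k<Suc n. ?g k \<in> sym_component C d k"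
    using f(1) x(1) by (auto simp: less_Suc_eq sym_component_def)
  ultimately show ?case by blast
qed

lemma sym_component_in_filtration:
  assumes "a \<in> sym_component C d k" "k < n"
  shows "a \<in> filtration n"
proof -
  obtain x where x: "x \<in> C" "a = symmetrised d k x"
    using assms(1) by (auto simp: sym_component_def)
  then have "a - x * d ^ k \<in> filtration n"
    using symmetrised_leading_term filtration_mono[of k n] assms(2) by auto
  from filtration_add[OF this filtration_gen[OF x(1) assms(2)]] show ?thesis by simp
qed

text \<open>The passage between monomials and symmetrised elements is triangular with unit diagonal.
  Closure under commutators can then be checked on the filtration, where products are easy to
  control.\<close>

lemma sym_space_eq_filtration: "sym_space C d = (\<Union>n. filtration n)"
proof (intro equalityI subsetI)
  fix a assume "a \<in> sym_space C d"
  then obtain n f where "a = (\<Sum>k<n. f k)" "\<forall>k<n. f k \<in> sym_component C d k"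
    by (auto simp: sym_space_def)
  then have "a \<in> filtration n"
    by (auto intro!: subspace_sum[OF subspace_filtration] sym_component_in_filtration)
  then show "a \<in> (\<Union>n. filtration n)" by blast
next
  fix a assume "a \<in> (\<Union>n. filtration n)"
  then show "a \<in> sym_space C d"
    using filtration_sym_sum by (fastforce simp: sym_space_def)
qed

section \<open>The generated Lie algebra inside the symmetrised space\<close>

lemma C_subset_sym_space: "C \<subseteq> sym_space C d"
  using filtration_gen[of _ 0 1] by (auto simp: sym_space_eq_filtration)

text \<open>Since \<open>1 \<in> C\<close>, each power of \<open>d\<close> is a monomial of the
  filtration.\<close>

lemma polys_in_subset_sym_space: "polys_in d \<subseteq> sym_space C d"
proof -
  have "poly_at d p \<in> filtration (Suc (degree p))" for p
    unfolding poly_at_def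
    using filtration_gen[OF one_in_C]
    by (auto intro!: subspace_sum[OF subspace_filtration] filtration_scale simp: less_Suc_eq_le)
  then show ?thesis by (auto simp: polys_in_def sym_space_eq_filtration)
qed

lemma lie_subalgebra_sym_space: "lie_subalgebra (sym_space C d)"
  unfolding lie_subalgebra_def sym_space_eq_filtration
proof (intro conjI ballI subspaceI)
  fix a b assume "a \<in> (\<Union>n. filtration n)" "b \<in> (\<Union>n. filtration n)"
  then obtain m n where mn: "a \<in> filtration m" "b \<in> filtration n" by blast
  \<comment> \<open>WRONG\<close>
  then have "a \<in> filtration (m + n)" "b \<in> filtration (m + n)"
    using filtration_mono[of m "m + n"] filtration_mono[of n "m + n"] by auto
  then show "a + b \<in> (\<Union>n. filtration n)" using filtration_add by blast
  have "a * b \<in> filtration (m + n)" "b * a \<in> filtration (m + n)"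
    using filtration_mult mn by (metis add.commute)+
  then show "commutator a b \<in> (\<Union>n. filtration n)"
    unfolding commutator_def using filtration_diff by blast
qed (use filtration_zero filtration_scale in blast)+

lemma FLA_subset_sym_space: "FLA (C \<union> polys_in d) \<subseteq> sym_space C d"
  unfolding FLA_def
  using lie_subalgebra_sym_space C_subset_sym_space polys_in_subset_sym_space by blast

lemma filtration_subset_lie_subalgebra:
  assumes L: "lie_subalgebra L" "C \<union> polys_in d \<subseteq> L"
    and E: "right_inverse_on C (ad d) E"
  shows "filtration n \<subseteq> L"
proof (induction n)
  case 0
  show ?case using L by (auto simp: filtration_def lie_subalgebra_def dest: subspace_0)
next
  case (Suc k)
  have sub: "subspace L" using L by (simp add: lie_subalgebra_def)
  have top: "x * d ^ k \<in> L" if x: "x \<in> C" for x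
  proof -
    define y where "y = E x"
    have y: "y \<in> C" "ad d y = x" using E x by (auto simp: right_inverse_on_def y_def)
    have "d ^ Suc k \<in> polys_in d"
      unfolding polys_in_def using poly_at_monom by (metis rangeI)
    then have "d ^ Suc k * y - y * d ^ Suc k \<in> L"
      using L y unfolding lie_subalgebra_def commutator_def by blast
    moreover have "d ^ Suc k * y - y * d ^ Suc k - scale (of_nat (Suc k)) (x * d ^ k) \<in> L"
      using power_commutation[OF y(1), of k] y(2) Suc.IH by auto
    ultimately have "scale (of_nat (Suc k)) (x * d ^ k) \<in> L"
      using subspace_diff[OF sub] by fastforce
    from subspace_scale[OF sub this, of "1 / of_nat (Suc k)"] show ?thesis
      by (simp del: of_nat_Suc)
  qed
  show ?case
  proof
    fix a assume "a \<in> filtration (Suc k)"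
    then obtain x where "x \<in> C" "a - x * d ^ k \<in> filtration k"
      using filtration_Suc_split by blast
    then have "(a - x * d ^ k) + x * d ^ k \<in> L"
      using Suc.IH top subspace_add[OF sub] by blast
    then show "a \<in> L" by simp
  qed
qed

lemma FLA_eq_sym_space:
  assumes "right_inverse_on C (ad d) E"
  shows "FLA (C \<union> polys_in d) = sym_space C d"
proof
  show "sym_space C d \<subseteq> FLA (C \<union> polys_in d)"
    unfolding FLA_def sym_space_eq_filtration
    using filtration_subset_lie_subalgebra[OF _ _ assms] by blast
qed (rule FLA_subset_sym_space)

end

theorem lemma7:
  fixes scale :: "rat \<Rightarrow> 'a::ring_1 \<Rightarrow> 'a"
    and C :: "'a set" and d :: 'a
  assumes "rational_algebra scale"
    and "rational_algebra.commutative_subalgebra scale C"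
    and "d \<in> lie_idealiser C - C"
  shows "rational_algebra.FLA scale (C \<union> rational_algebra.polys_in scale d)
           \<subseteq> rational_algebra.sym_space scale C d
       \<and> ((\<exists>E. right_inverse_on C (ad d) E) \<longrightarrow>
            rational_algebra.FLA scale (C \<union> rational_algebra.polys_in scale d)
              = rational_algebra.sym_space scale C d)"
proof -
  interpret commutative_subalgebra_idealised scale C d
    using assms
    by (simp add: commutative_subalgebra_idealised_def commutative_subalgebra_idealised_axioms_def)
  show ?thesis
    using FLA_subset_sym_space FLA_eq_sym_space by blast
qed

end
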